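(* Let $f:[0,1]^2\to\mathbb{R}$ be a concave function whose restriction to $\{0,1\}^2$ is supermodular. Let $S^2_1:=\{(0,0),(1,0),(0,1)\}$ and $S^2_2:=\{(1,1),(1,0),(0,1)\}$. Then $\{\mathrm{conv}(S^2_1),\mathrm{conv}(S^2_2)\}$ is a triangulation of $[0,1]^2$, and $S^2_1$, $S^2_2$ induce facets of $\mathrm{convenv}_{[0,1]^2}(f)$, i.e. for each $k\in\{1,2\}$ the interpolation function $f_{S^2_k}$ is a facet of $\mathrm{convenv}_{[0,1]^2}(f)$.
   Context: Supermodular on $\{0,1\}^2$: for all $w^1,w^2\in\{0,1\}^2$ and $d\in\mathbb{R}^2_+$ with $w^1\le w^2$ (entry-wise) and $w^1+d,w^2+d\in\{0,1\}^2$, $f(w^1+d)-f(w^1)\le f(w^2+d)-f(w^2)$. A finite set of polyhedra $P_1,\dots,P_t\subseteq\mathcal{U}$, where $\mathcal{U}=[0,1]^2$, is a triangulation of $\mathcal{U}$ if $\mathcal{U}=\bigcup_i P_i$, each $P_i\cap P_j$ is a (possibly empty) face of both $P_i$ and $P_j$, and each $P_i$ is a 2-simplex (convex hull of 3 affinely independent points). For a set $S$ of 3 affinely independent points of $\{0,1\}^2$, the interpolation function $f_S:\mathbb{R}^2\to\mathbb{R}$ is the unique affine function with $f_S(w)=f(w)$ for all $w\in S$. Explicitly, $f_{S^2_1}(w)=f(0,0)+(f(1,0)-f(0,0))w_1+(f(0,1)-f(0,0))w_2$ and $f_{S^2_2}(w)=f(1,1)+(f(0,1)-f(1,1))(1-w_1)+(f(1,0)-f(1,1))(1-w_2)$.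 $\mathrm{convenv}_{[0,1]^2}(f)$ is the convex envelope of $f$ over $[0,1]^2$, i.e. the pointwise maximum convex function on $[0,1]^2$ that is $\le f$ on $[0,1]^2$. An affine underestimator $a\cdot w+b$ of $\mathrm{convenv}_{[0,1]^2}(f)$ is called a facet of it if the inequality $a\cdot w+b\le t$ defines a facet of its epigraph $\{(w,t): w\in[0,1]^2,\ \mathrm{convenv}_{[0,1]^2}(f)(w)\le t\}$. *)

theory Defs
  imports "HOL-Analysis.Analysis"
begin

abbreviation unit_square :: "(real^2) set" where
  "unit_square \<equiv> cbox 0 1"

definition binary_points :: "(real^2) set" where
  "binary_points = {w. \<forall>i. w $ i \<in> {0, 1}}"

definition supermodular_on_binary :: "(real^2 \<Rightarrow> real) \<Rightarrow> bool" where
  "supermodular_on_binary f \<longleftrightarrow>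
     (\<forall>w1\<in>binary_points. \<forall>w2\<in>binary_points. \<forall>d\<ge>0.
        w1 \<le> w2 \<and> w1 + d \<in> binary_points \<and> w2 + d \<in> binary_points \<longrightarrow>
          f (w1 + d) - f w1 \<le> f (w2 + d) - f w2)"

text \<open>The library predicate \<open>triangulation\<close> requires neither full-dimensional simplices
  nor a prescribed union, so the notion relative to a planar region is spelled out here.\<close>

definition triangulation_of :: "(real^2) set set \<Rightarrow> (real^2) set \<Rightarrow> bool" where
  "triangulation_of T U \<longleftrightarrow>
     finite T \<and>
     (\<forall>P\<in>T. polyhedron P \<and> P \<subseteq> U) \<and>
     U = \<Union>T \<and>
     (\<forall>P\<in>T. \<forall>Q\<in>T. (P \<inter> Q) face_of P \<and> (P \<inter> Q) face_of Q) \<and>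
     (\<forall>P\<in>T. 2 simplex P)"

definition affine_function :: "(real^2 \<Rightarrow> real) \<Rightarrow> bool" where
  "affine_function h \<longleftrightarrow> (\<exists>a b. h = (\<lambda>w. a \<bullet> w + b))"

text \<open>Meaningful only if \<open>S\<close> consists of three affinely independent points.\<close>

definition interpolation :: "(real^2) set \<Rightarrow> (real^2 \<Rightarrow> real) \<Rightarrow> real^2 \<Rightarrow> real" where
  "interpolation S f = (THE h. affine_function h \<and> (\<forall>w\<in>S. h w = f w))"

text \<open>Only the values on \<open>C\<close> are meaningful. The supremum is over a bounded nonempty set as
  soon as \<open>f\<close> has some convex minorant on \<open>C\<close>; it is then the largest one, as the
  lemmas below show.\<close>

definition convenv :: "'a::real_vector set \<Rightarrow> ('a \<Rightarrow> real) \<Rightarrow> 'a \<Rightarrow> real" where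
  "convenv C f w = Sup {g w | g. convex_on C g \<and> (\<forall>x\<in>C. g x \<le> f x)}"

definition facet_of_convenv :: "(real^2 \<Rightarrow> real) \<Rightarrow> (real^2) set \<Rightarrow> (real^2 \<Rightarrow> real) \<Rightarrow> bool" where
  "facet_of_convenv h C f \<longleftrightarrow>
     affine_function h \<and>
     (\<forall>w\<in>C. h w \<le> convenv C f w) \<and>
     {p \<in> epigraph C (convenv C f). h (fst p) = snd p} facet_of epigraph C (convenv C f)"

definition S1 :: "(real^2) set" where
  "S1 = {vector [0, 0], vector [1, 0], vector [0, 1]}"

definition S2 :: "(real^2) set" where
  "S2 = {vector [1, 1], vector [1, 0], vector [0, 1]}"

lemma convenv_upper:
  assumes "convex_on C g" "\<And>x. x \<in> C \<Longrightarrow> g x \<le> f x" "w \<in> C"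
  shows "g w \<le> convenv C f w"
  unfolding convenv_def
proof (rule cSup_upper)
  show "bdd_above {g w | g. convex_on C g \<and> (\<forall>x\<in>C. g x \<le> f x)}"
    using assms(3) by (auto intro!: bdd_aboveI[of _ "f w"])
qed (use assms in blast)

lemma convenv_le:
  assumes "convex_on C g" "\<And>x. x \<in> C \<Longrightarrow> g x \<le> f x" "w \<in> C"
  shows "convenv C f w \<le> f w"
  unfolding convenv_def
  by (rule cSup_least) (use assms in auto)

lemma convex_on_convenv:
  assumes "convex_on C g" "\<And>x. x \<in> C \<Longrightarrow> g x \<le> f x"
  shows "convex_on C (convenv C f)"
proof -
  have C: "convex C" using assms(1) by (simp add: convex_on_def)
  have "convenv C f (u *\<^sub>R x + v *\<^sub>R y) \<le> u * convenv C f x + v * convenv C f y"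
    if xy: "x \<in> C" "y \<in> C" and uv: "0 \<le> u" "0 \<le> v" "u + v = 1" for x y u v
  proof -
    have "h (u *\<^sub>R x + v *\<^sub>R y) \<le> u * convenv C f x + v * convenv C f y"
      if h: "convex_on C h" "\<And>x. x \<in> C \<Longrightarrow> h x \<le> f x" for h
    proof -
      have "h (u *\<^sub>R x + v *\<^sub>R y) \<le> u * h x + v * h y"
        using h(1) xy uv by (simp add: convex_on_def)
      also have "\<dots> \<le> u * convenv C f x + v * convenv C f y"
        using convenv_upper[OF h] xy uv by (intro add_mono mult_left_mono) auto
      finally show ?thesis .
    qed
    then show ?thesis
      unfolding convenv_def[of C f "u *\<^sub>R x + v *\<^sub>R y"]
      by (intro cSup_least) (use assms in auto)
  qed
  with C show ?thesis by (simp add: convex_on_def)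
qed

lemma affine_function_coords:
  "affine_function h \<longleftrightarrow> (\<exists>a1 a2 b. h = (\<lambda>w. b + a1 * w $ 1 + a2 * w $ 2))"
proof
  assume "affine_function h"
  then obtain a b where "h = (\<lambda>w. a \<bullet> w + b)" unfolding affine_function_def by blast
  then have "h = (\<lambda>w. b + a $ 1 * w $ 1 + a $ 2 * w $ 2)"
    by (simp add: inner_vec_def sum_2 algebra_simps)
  then show "\<exists>a1 a2 b. h = (\<lambda>w. b + a1 * w $ 1 + a2 * w $ 2)" by blast
next
  assume "\<exists>a1 a2 b. h = (\<lambda>w. b + a1 * w $ 1 + a2 * w $ 2)"
  then obtain a1 a2 b where "h = (\<lambda>w. b + a1 * w $ 1 + a2 * w $ 2)" by blast
  then have "h = (\<lambda>w. vector [a1, a2] \<bullet> w + b)"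
    by (simp add: inner_vec_def sum_2 algebra_simps)
  then show "affine_function h" unfolding affine_function_def by blast
qed

lemma interpolation_S1:
  "interpolation S1 f = (\<lambda>w. f (vector [0, 0])
     + (f (vector [1, 0]) - f (vector [0, 0])) * w $ 1
     + (f (vector [0, 1]) - f (vector [0, 0])) * w $ 2)"
  unfolding interpolation_def
proof (rule the_equality)
  fix h assume "affine_function h \<and> (\<forall>w\<in>S1. h w = f w)"
  then obtain a1 a2 b where h: "h = (\<lambda>w. b + a1 * w $ 1 + a2 * w $ 2)"
    and S1: "\<forall>w\<in>S1. h w = f w"
    unfolding affine_function_coords by blast
  then have "f (vector [0, 0]) = b" "f (vector [1, 0]) = b + a1" "f (vector [0, 1]) = b + a2"
    by (simp_all add: S1_def)
  then show "h = (\<lambda>w. f (vector [0, 0])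
     + (f (vector [1, 0]) - f (vector [0, 0])) * w $ 1
     + (f (vector [0, 1]) - f (vector [0, 0])) * w $ 2)"
    by (simp add: h)
qed (auto simp: affine_function_coords S1_def)

lemma interpolation_S2:
  "interpolation S2 f = (\<lambda>w. f (vector [1, 1])
     + (f (vector [0, 1]) - f (vector [1, 1])) * (1 - w $ 1)
     + (f (vector [1, 0]) - f (vector [1, 1])) * (1 - w $ 2))"
  unfolding interpolation_def
proof (rule the_equality)
  show "affine_function (\<lambda>w. f (vector [1, 1])
     + (f (vector [0, 1]) - f (vector [1, 1])) * (1 - w $ 1)
     + (f (vector [1, 0]) - f (vector [1, 1])) * (1 - w $ 2)) \<and>
    (\<forall>w\<in>S2. f (vector [1, 1])
     + (f (vector [0, 1]) - f (vector [1, 1])) * (1 - w $ 1)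
     + (f (vector [1, 0]) - f (vector [1, 1])) * (1 - w $ 2) = f w)"
    unfolding affine_function_coords
    by (intro conjI exI[of _ "f (vector [1, 1]) - f (vector [0, 1])"]
          exI[of _ "f (vector [1, 1]) - f (vector [1, 0])"]
          exI[of _ "f (vector [0, 1]) + f (vector [1, 0]) - f (vector [1, 1])"])
       (auto simp: S2_def algebra_simps)
next
  fix h assume "affine_function h \<and> (\<forall>w\<in>S2. h w = f w)"
  then obtain a1 a2 b where h: "h = (\<lambda>w. b + a1 * w $ 1 + a2 * w $ 2)"
    and S2: "\<forall>w\<in>S2. h w = f w"
    unfolding affine_function_coords by blast
  then have "f (vector [1, 1]) = b + a1 + a2" "f (vector [1, 0]) = b + a1"
    "f (vector [0, 1]) = b + a2"
    by (simp_all add: S2_def)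
  then show "h = (\<lambda>w. f (vector [1, 1])
     + (f (vector [0, 1]) - f (vector [1, 1])) * (1 - w $ 1)
     + (f (vector [1, 0]) - f (vector [1, 1])) * (1 - w $ 2))"
    by (simp add: h algebra_simps)
qed

end

(* On vertices of the square, supermodularity says that each of the two interpolants lies below f;
   as f minus an affine function is concave, the interpolant then lies below f on the whole square
   and hence below the convex envelope.  It agrees with f, and so with the envelope, on three
   affinely independent points, whose lifts span a supporting hyperplane of the epigraph. *)

theory Submission
  imports Defs
begin

lemma affine_function_convex_on:
  assumes "affine_function h" "convex C"
  shows "convex_on C h"
proof -
  obtain a b where h: "h = (\<lambda>w. a \<bullet> w + b)"
    using assms(1) unfolding affine_function_def by blast
  have "h (u *\<^sub>R x + v *\<^sub>R y) = u * h x + v * h y" if "u + v = 1" for u v :: real and x y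
  proof -
    have "b = u * b + v * b" using that by (metis distrib_right mult_1)
    then show ?thesis by (simp add: h inner_add_right algebra_simps)
  qed
  with assms(2) show ?thesis by (simp add: convex_on_def)
qed

text \<open>Maximum principle for the convex function \<open>h - f\<close>: a bound at the points of
  \<open>V\<close> persists on their hull.\<close>

lemma affine_le_concave_on_convex_hull:
  assumes "affine_function h" "concave_on (convex hull V) f"
    and "\<And>v. v \<in> V \<Longrightarrow> h v \<le> f v" and "w \<in> convex hull V"
  shows "h w \<le> f w"
proof -
  have "convex_on (convex hull V) (\<lambda>x. h x + (- f x))"
    using assms(1,2) by (intro convex_on_add) (auto simp: concave_on_def affine_function_convex_on)
  then have "\<forall>x\<in>convex hull V. h x + (- f x) \<le> 0"
    using assms(3) by (intro convex_on_convex_hull_bound) auto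
  with assms(4) show ?thesis by auto
qed

text \<open>The graph of \<open>h\<close> is a hyperplane supporting the epigraph from below. The
  face it cuts out projects onto a set containing \<open>S\<close>, which leaves only one possible
  dimension for it.\<close>

lemma facet_of_convenvI:
  assumes h: "affine_function h" and C: "convex C" and le: "\<And>w. w \<in> C \<Longrightarrow> h w \<le> f w"
    and S: "S \<subseteq> C" "aff_dim S = 2" "\<And>w. w \<in> S \<Longrightarrow> h w = f w"
  shows "facet_of_convenv h C f"
proof -
  obtain a b where hab: "h = (\<lambda>w. a \<bullet> w + b)"
    using h unfolding affine_function_def by blast
  have hC: "convex_on C h" using h C by (rule affine_function_convex_on)
  have hle: "h w \<le> convenv C f w" if "w \<in> C" for w
    using convenv_upper[OF hC le that] .
  \<comment> \<open>The envelope is squeezed between \<open>h\<close> and \<open>f\<close>, which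
    agree on \<open>S\<close>.\<close>
  have eq: "convenv C f w = h w" if "w \<in> S" for w
    using convenv_le[OF hC le, of w] hle[of w] S that by force
  define E where "E = epigraph C (convenv C f)"
  define F where "F = {p \<in> E. h (fst p) = snd p}"
  have "convex E"
    using convex_on_convenv[OF hC le] C by (simp add: E_def convex_epigraph)
  \<comment> \<open>With normal \<open>(a, -1)\<close>, the equation h(w) = t reads a \<bullet> w -
    t = -b.\<close>
  moreover have "F = E \<inter> {p. (a, -1) \<bullet> p = - b}"
    by (auto simp: F_def hab)
  moreover have "(a, -1) \<bullet> p \<le> - b" if "p \<in> E" for p
    using that hle[of "fst p"] by (auto simp: E_def epigraph_def hab inner_prod_def)
  ultimately have face: "F face_of E"
    by (simp add: face_of_Int_supporting_hyperplane_le)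
  have "(w, h w) \<in> F" if "w \<in> S" for w
    using that S(1) eq by (auto simp: F_def E_def epigraph_def)
  \<comment> \<open>A linear projection cannot raise the affine dimension, so \<open>F\<close> has
    at least that of \<open>S\<close>.\<close>
  then have "S \<subseteq> fst ` F" by force
  then have "aff_dim S \<le> aff_dim (fst ` F)" by (rule aff_dim_subset)
  also have "\<dots> \<le> aff_dim F" by (rule aff_dim_linear_image_le[OF linear_fst])
  finally have F2: "2 \<le> aff_dim F" using S by simp
  obtain s where s: "s \<in> S" using S(2) by force
  \<comment> \<open>A point strictly above the graph of \<open>h\<close> shows that the face is
    proper, hence of smaller dimension than \<open>E\<close>.\<close>
  then have "(s, h s + 1) \<in> E - F"
    using S(1) eq by (auto simp: F_def E_def epigraph_def)
  then have "aff_dim F < aff_dim E"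
    using face_of_aff_dim_lt[OF \<open>convex E\<close> face] by blast
  moreover have "aff_dim E \<le> 3" using aff_dim_le_DIM[of E] by simp
  \<comment> \<open>From 2 \<le> dim F < dim E \<le> 3, the dimensions must be 2 and 3.\<close>
  ultimately have "aff_dim F = aff_dim E - 1" using F2 by linarith
  moreover have "F \<noteq> {}" using F2 by force
  ultimately have "F facet_of E" using face by (simp add: facet_of_def)
  with h hle show ?thesis by (simp add: facet_of_convenv_def F_def E_def)
qed

lemma vec2_eq_iff: "v = w \<longleftrightarrow> v $ 1 = w $ 1 \<and> v $ 2 = w $ 2" for v w :: "'a^2"
  by (simp add: vec_eq_iff forall_2)

lemma mem_unit_square: "w \<in> unit_square \<longleftrightarrow> 0 \<le> w $ 1 \<and> w $ 1 \<le> 1 \<and> 0 \<le> w $ 2 \<and> w $ 2 \<le> 1"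
  by (auto simp: mem_box_cart forall_2)

lemma convex_hull_S1: "convex hull S1 = {w. 0 \<le> w $ 1 \<and> 0 \<le> w $ 2 \<and> w $ 1 + w $ 2 \<le> 1}"
proof (intro set_eqI iffI)
  fix w :: "real^2" assume "w \<in> {w. 0 \<le> w $ 1 \<and> 0 \<le> w $ 2 \<and> w $ 1 + w $ 2 \<le> 1}"
  \<comment> \<open>The witnesses are the barycentric coordinates of \<open>w\<close> with respect
    to (0,0), (1,0), (0,1).\<close>
  then show "w \<in> convex hull S1"
    unfolding S1_def convex_hull_3 mem_Collect_eq
    by (intro exI[of _ "1 - w $ 1 - w $ 2"] exI[of _ "w $ 1"] exI[of _ "w $ 2"])
       (simp add: vec2_eq_iff)
qed (auto simp: S1_def convex_hull_3)

lemma convex_hull_S2: "convex hull S2 = {w. w $ 1 \<le> 1 \<and> w $ 2 \<le> 1 \<and> 1 \<le> w $ 1 + w $ 2}"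
proof (intro set_eqI iffI)
  fix w :: "real^2" assume "w \<in> {w. w $ 1 \<le> 1 \<and> w $ 2 \<le> 1 \<and> 1 \<le> w $ 1 + w $ 2}"
  \<comment> \<open>Barycentric coordinates again, now with respect to (1,1), (1,0), (0,1).\<close>
  then show "w \<in> convex hull S2"
    unfolding S2_def convex_hull_3 mem_Collect_eq
    by (intro exI[of _ "w $ 1 + w $ 2 - 1"] exI[of _ "1 - w $ 2"] exI[of _ "1 - w $ 1"])
       (simp add: vec2_eq_iff)
qed (auto simp: S2_def convex_hull_3)

lemma unit_square_eq_Un: "unit_square = convex hull S1 \<union> convex hull S2"
  unfolding convex_hull_S1 convex_hull_S2 by (auto simp: mem_unit_square)

lemma unit_square_eq_convex_hull: "unit_square = convex hull (S1 \<union> S2)"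
proof
  show "unit_square \<subseteq> convex hull (S1 \<union> S2)"
    unfolding unit_square_eq_Un by (simp add: hull_mono)
  show "convex hull (S1 \<union> S2) \<subseteq> unit_square"
    by (intro hull_minimal) (auto simp: S1_def S2_def mem_unit_square)
qed

text \<open>The barycentric coordinates, freed of sign conditions, express every point of the
  plane.\<close>

lemma aff_dim_S1: "aff_dim S1 = 2"
proof -
  have "w \<in> affine hull S1" for w :: "real^2"
    unfolding S1_def affine_hull_3 mem_Collect_eq
    by (intro exI[of _ "1 - w $ 1 - w $ 2"] exI[of _ "w $ 1"] exI[of _ "w $ 2"])
       (simp add: vec2_eq_iff)
  then have "affine hull S1 = UNIV" by blast
  then show ?thesis using aff_dim_eq_full[of S1] by simp
qed

lemma aff_dim_S2: "aff_dim S2 = 2"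
proof -
  have "w \<in> affine hull S2" for w :: "real^2"
    unfolding S2_def affine_hull_3 mem_Collect_eq
    by (intro exI[of _ "w $ 1 + w $ 2 - 1"] exI[of _ "1 - w $ 2"] exI[of _ "1 - w $ 1"])
       (simp add: vec2_eq_iff)
  then have "affine hull S2 = UNIV" by blast
  then show ?thesis using aff_dim_eq_full[of S2] by simp
qed

lemma simplex_convex_hull:
  assumes "finite S" "aff_dim S = n" "int (card S) = n + 1"
  shows "n simplex (convex hull S)"
  using assms unfolding simplex_def by (auto simp: affine_independent_iff_card)

lemma card_S1: "card S1 = 3" and card_S2: "card S2 = 3"
  by (simp_all add: S1_def S2_def vec2_eq_iff)

lemma triangulation_unit_square: "triangulation_of {convex hull S1, convex hull S2} unit_square"
proof -
  let ?T1 = "convex hull S1" and ?T2 = "convex hull S2"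
  have fin: "finite S1" "finite S2" by (simp_all add: S1_def S2_def)
  have "polyhedron ?T1" "polyhedron ?T2"
    using fin by (auto intro!: polytope_imp_polyhedron simp: polytope_def)
  moreover have "2 simplex ?T1" "2 simplex ?T2"
    using fin by (simp_all add: simplex_convex_hull aff_dim_S1 aff_dim_S2 card_S1 card_S2)
  moreover have inner: "1 \<bullet> w = w $ 1 + w $ 2" for w :: "real^2"
    by (simp add: inner_vec_def sum_2)
  \<comment> \<open>The triangles share the antidiagonal, where the all-ones vector \<open>1\<close>
    has inner product 1 with \<open>w\<close>. This line supports them from opposite sides.\<close>
  have "?T1 \<inter> ?T2 = ?T1 \<inter> {w. 1 \<bullet> w = 1}" "?T1 \<inter> ?T2 = ?T2 \<inter> {w. 1 \<bullet> w = 1}"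
    unfolding convex_hull_S1 convex_hull_S2 inner by auto
  moreover have "(?T1 \<inter> {w. 1 \<bullet> w = 1}) face_of ?T1"
    by (rule face_of_Int_supporting_hyperplane_le[OF convex_convex_hull])
       (simp add: inner convex_hull_S1)
  moreover have "(?T2 \<inter> {w. 1 \<bullet> w = 1}) face_of ?T2"
    by (rule face_of_Int_supporting_hyperplane_ge[OF convex_convex_hull])
       (simp add: inner convex_hull_S2)
  ultimately show ?thesis
    unfolding triangulation_of_def
    by (simp add: Int_commute[of ?T2] face_of_refl unit_square_eq_Un)
qed

lemma supermodular_on_binary_vertices:
  assumes "supermodular_on_binary f"
  shows "f (vector [1, 0]) + f (vector [0, 1]) \<le> f (vector [0, 0]) + f (vector [1, 1])"
proof -
  \<comment> \<open>Supermodularity is applied to the two vertical edges: the rise of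
    \<open>f\<close> along the left edge is at most its rise along the right one.\<close>
  let ?d = "vector [0, 1] :: real^2"
  have d: "vector [0, 0] + ?d = vector [0, 1]" "vector [1, 0] + ?d = vector [1, 1]"
    by (simp_all add: vec2_eq_iff)
  have bin: "vector [0, 0] \<in> binary_points" "vector [1, 0] \<in> binary_points"
    "vector [0, 1] \<in> binary_points" "vector [1, 1] \<in> binary_points"
    by (simp_all add: binary_points_def forall_2)
  have le: "0 \<le> ?d" "(vector [0, 0] :: real^2) \<le> vector [1, 0]"
    by (simp_all add: less_eq_vec_def forall_2)
  have "f (vector [0, 0] + ?d) - f (vector [0, 0]) \<le> f (vector [1, 0] + ?d) - f (vector [1, 0])"
    using assms bin le d unfolding supermodular_on_binary_def by metis
  then show ?thesis unfolding d by simp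
qed

theorem theorem3:
  fixes f :: "real^2 \<Rightarrow> real"
  assumes "concave_on unit_square f"
    and "supermodular_on_binary f"
  shows "triangulation_of {convex hull S1, convex hull S2} unit_square \<and>
         facet_of_convenv (interpolation S1 f) unit_square f \<and>
         facet_of_convenv (interpolation S2 f) unit_square f"
proof (intro conjI triangulation_unit_square)
  note sm = supermodular_on_binary_vertices[OF assms(2)]
  have conc: "concave_on (convex hull (S1 \<union> S2)) f"
    using assms(1) by (simp flip: unit_square_eq_convex_hull)
  have sub: "S1 \<subseteq> unit_square" "S2 \<subseteq> unit_square"
    unfolding unit_square_eq_Un by (auto intro: hull_inc)
  let ?h1 = "interpolation S1 f" and ?h2 = "interpolation S2 f"
  have h1: "affine_function ?h1"
    unfolding interpolation_S1 affine_function_coords by blast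
  \<comment> \<open>Equality holds on \<open>S1\<close>. At (1,1) the interpolant equals f(1,0) +
    f(0,1) - f(0,0), so the claim there is \<open>sm\<close>.\<close>
  have le1: "?h1 v \<le> f v" if "v \<in> S1 \<union> S2" for v
    using that sm unfolding interpolation_S1 by (auto simp: S1_def S2_def)
  show "facet_of_convenv ?h1 unit_square f"
  proof (rule facet_of_convenvI[OF h1 _ _ sub(1) aff_dim_S1])
    show "?h1 w \<le> f w" if "w \<in> unit_square" for w
      using affine_le_concave_on_convex_hull[OF h1 conc le1] that
      by (simp add: unit_square_eq_convex_hull)
  qed (unfold interpolation_S1, auto simp: S1_def)
  have h2: "affine_function ?h2"
    unfolding interpolation_S2 affine_function_coords
    \<comment> \<open>The witnesses are the two slopes and the value at the origin, read off by
      expanding the formula based at (1,1).\<close>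
    by (intro exI[of _ "f (vector [1, 1]) - f (vector [0, 1])"]
          exI[of _ "f (vector [1, 1]) - f (vector [1, 0])"]
          exI[of _ "f (vector [0, 1]) + f (vector [1, 0]) - f (vector [1, 1])"])
       (auto simp: algebra_simps)
  \<comment> \<open>Here the vertex outside \<open>S2\<close> is (0,0), and \<open>sm\<close>
    rearranges to the bound needed there.\<close>
  have le2: "?h2 v \<le> f v" if "v \<in> S1 \<union> S2" for v
    using that sm unfolding interpolation_S2 by (auto simp: S1_def S2_def)
  show "facet_of_convenv ?h2 unit_square f"
  proof (rule facet_of_convenvI[OF h2 _ _ sub(2) aff_dim_S2])
    show "?h2 w \<le> f w" if "w \<in> unit_square" for w
      using affine_le_concave_on_convex_hull[OF h2 conc le2] that
      by (simp add: unit_square_eq_convex_hull)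
  qed (unfold interpolation_S2, auto simp: S2_def)
qed

end
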